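(* Let $G$ be a graph with vertex set $V$ and let $\emptyset\neq D\subseteq V$. The complemented neighborhood function $\bar N: u\mapsto V\setminus N_G(u)$ is an interference of $D$ (with respect to the complete graph on $V$) if and only if $G$ is point-determining and every vertex $u\notin D$ that is adjacent to all vertices in $D$ has a nonneighbor that is not adjacent to all vertices in $D$ (equivalently, $u\in\big[\bigcap_{v\in D}N(v)\big]\setminus D$ implies $\bar N(u)\not\subseteq\bigcap_{v\in D}N(v)$).
   Context: All graphs are finite and simple. $N(u)=N_G(u)$ is the open neighborhood of $u$ in $G$ and $\bar N(u)=V\setminus N_G(u)$. The function $\bar N: V\to 2^V$ is an interference of $D$ with respect to the complete graph on $V$ if $\bar N$ is injective, $\bar N(u)\ne\emptyset$ for all $u\in V$, and for every $u\in V\setminus D$ there is $v\in D$ with $\bar N(u)\cap\bar N(v)\neq\emptyset$. $G$ is point-determining if distinct vertices have distinct open neighborhoods. *)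

theory Defs
  imports "Graph_Theory.Pair_Digraph"
begin

text \<open>Finite simple graphs are the finite, symmetric, loop-free digraphs of
  \<^locale>\<open>pair_graph\<close>; the arcs are the ordered pairs of adjacent vertices.\<close>

definition open_nbhd :: "'a pair_pre_digraph \<Rightarrow> 'a \<Rightarrow> 'a set" where
  "open_nbhd G u = {v \<in> pverts G. (u, v) \<in> parcs G}"

text \<open>Note that the complemented neighborhood of a vertex contains the vertex itself.\<close>

definition co_nbhd :: "'a pair_pre_digraph \<Rightarrow> 'a \<Rightarrow> 'a set" where
  "co_nbhd G u = pverts G - open_nbhd G u"

definition point_determining :: "'a pair_pre_digraph \<Rightarrow> bool" where
  "point_determining G \<longleftrightarrow>
    (\<forall>u \<in> pverts G. \<forall>v \<in> pverts G. u \<noteq> v \<longrightarrow> open_nbhd G u \<noteq> open_nbhd G v)"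

text \<open>\<open>f\<close> is an interference of \<open>D\<close> with respect to the complete graph on \<open>V\<close>.
  There is no adjacency requirement between \<open>u\<close> and \<open>v\<close> in the last clause, since distinct
  vertices of the complete graph are always adjacent.\<close>

definition interference_complete :: "'a set \<Rightarrow> 'a set \<Rightarrow> ('a \<Rightarrow> 'b set) \<Rightarrow> bool" where
  "interference_complete V D f \<longleftrightarrow>
    inj_on f V \<and>
    (\<forall>u \<in> V. f u \<noteq> {}) \<and>
    (\<forall>u \<in> V - D. \<exists>v \<in> D. f u \<inter> f v \<noteq> {})"

end

theory Submission
  imports Defs
begin

text \<open>Write \<open>C = (\<Inter>v \<in> D. N(v))\<close> for the common neighbors of \<open>D\<close>. A vertex \<open>w\<close> lies outside
  \<open>C\<close> exactly when it belongs to the complemented neighborhood of some \<open>v \<in> D\<close>, so the complemented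
  neighborhood of \<open>u\<close> meets that of a member of \<open>D\<close> if and only if it is not contained in \<open>C\<close>
  (\<open>co_nbhd_meets_iff\<close>). Since there are no loops, every vertex lies in its own complemented
  neighborhood. This gives nonemptiness of the values, and it makes a vertex \<open>u \<notin> C\<close> itself a
  witness for \<open>co_nbhd G u\<close> not being contained in \<open>C\<close>: the covering condition has content
  only at vertices of \<open>C - D\<close>. Finally, complementation within the vertex set is injective, so
  injectivity of the complemented neighborhoods is point-determination.\<close>

lemma (in pair_graph) mem_co_nbhd_self:
  assumes "u \<in> pverts G"
  shows "u \<in> co_nbhd G u"
  using assms no_loops'[of u u] by (auto simp: co_nbhd_def open_nbhd_def)

lemma inj_on_co_nbhd_iff_point_determining:
  "inj_on (co_nbhd G) (pverts G) \<longleftrightarrow> point_determining G"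
proof -
  have "co_nbhd G u = co_nbhd G v \<longleftrightarrow> open_nbhd G u = open_nbhd G v" for u v
    unfolding co_nbhd_def open_nbhd_def by blast
  then show ?thesis
    unfolding inj_on_def point_determining_def by blast
qed

lemma (in pair_graph) mem_common_nbhd_iff:
  assumes "w \<in> pverts G"
  shows "w \<in> (\<Inter>v \<in> D. open_nbhd G v) \<longleftrightarrow> (\<forall>v \<in> D. (w, v) \<in> parcs G)"
proof -
  have "(v, w) \<in> parcs G \<longleftrightarrow> (w, v) \<in> parcs G" for v
    using arcs_symmetric by metis
  then show ?thesis
    using assms by (simp add: open_nbhd_def)
qed

text \<open>De Morgan: within the vertex set, the complement of the common neighborhood of \<open>D\<close> is the
  union of the complemented neighborhoods of its members.\<close>

lemma co_nbhd_meets_iff: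
  "(\<exists>v \<in> D. co_nbhd G u \<inter> co_nbhd G v \<noteq> {}) \<longleftrightarrow>
    \<not> co_nbhd G u \<subseteq> (\<Inter>v \<in> D. open_nbhd G v)"
  unfolding co_nbhd_def by blast

text \<open>A vertex \<open>u\<close> outside the common neighborhood already violates the inclusion, as it is a
  member of \<open>co_nbhd G u\<close>; restricting the covering condition to common neighbors of \<open>D\<close>
  therefore loses nothing.\<close>

lemma (in pair_graph) interference_complete_co_nbhd_iff:
  "interference_complete (pverts G) D (co_nbhd G) \<longleftrightarrow>
    point_determining G \<and>
    (\<forall>u \<in> pverts G. u \<in> (\<Inter>v \<in> D. open_nbhd G v) - D \<longrightarrow>
      \<not> co_nbhd G u \<subseteq> (\<Inter>v \<in> D. open_nbhd G v))"
  unfolding interference_complete_def inj_on_co_nbhd_iff_point_determining co_nbhd_meets_iff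
  using mem_co_nbhd_self by blast

text \<open>A nonneighbor \<open>w\<close> is a member of \<open>co_nbhd G u\<close> other than \<open>u\<close>. When \<open>u\<close> is adjacent to all
  of \<open>D\<close>, the member \<open>u\<close> cannot violate the inclusion, so any violating member is a
  nonneighbor.\<close>

lemma (in pair_graph) nonneighbor_condition_iff:
  assumes "u \<in> pverts G"
  shows "(u \<notin> D \<and> (\<forall>v \<in> D. (u, v) \<in> parcs G) \<longrightarrow>
      (\<exists>w \<in> pverts G. w \<noteq> u \<and> (u, w) \<notin> parcs G \<and> \<not> (\<forall>v \<in> D. (w, v) \<in> parcs G)))
    \<longleftrightarrow>
    (u \<in> (\<Inter>v \<in> D. open_nbhd G v) - D \<longrightarrow>
      \<not> co_nbhd G u \<subseteq> (\<Inter>v \<in> D. open_nbhd G v))"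
proof -
  have "co_nbhd G u \<subseteq> (\<Inter>v \<in> D. open_nbhd G v) \<longleftrightarrow>
      (\<forall>w \<in> pverts G. (u, w) \<notin> parcs G \<longrightarrow> w \<in> (\<Inter>v \<in> D. open_nbhd G v))"
    unfolding co_nbhd_def open_nbhd_def by blast
  also have "\<dots> \<longleftrightarrow>
      (\<forall>w \<in> pverts G. (u, w) \<notin> parcs G \<longrightarrow> (\<forall>v \<in> D. (w, v) \<in> parcs G))"
    using mem_common_nbhd_iff by blast
  finally have subset_iff: "co_nbhd G u \<subseteq> (\<Inter>v \<in> D. open_nbhd G v) \<longleftrightarrow>
      (\<forall>w \<in> pverts G. (u, w) \<notin> parcs G \<longrightarrow> (\<forall>v \<in> D. (w, v) \<in> parcs G))" .
  define P where "P w \<longleftrightarrow> (\<forall>v \<in> D. (w, v) \<in> parcs G)" for w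
  have "w \<noteq> u" if "P u" and "\<not> P w" for w
    using that by auto
  then show ?thesis
    unfolding Diff_iff mem_common_nbhd_iff[OF assms] subset_iff P_def[symmetric] by blast
qed

theorem theorem4p13:
  fixes G :: "'a pair_pre_digraph" and D :: "'a set"
  assumes "pair_graph G" and "D \<noteq> {}" and "D \<subseteq> pverts G"
  shows "(interference_complete (pverts G) D (co_nbhd G) \<longleftrightarrow>
      point_determining G \<and>
      (\<forall>u \<in> pverts G. u \<notin> D \<and> (\<forall>v \<in> D. (u, v) \<in> parcs G) \<longrightarrow>
        (\<exists>w \<in> pverts G. w \<noteq> u \<and> (u, w) \<notin> parcs G \<and> \<not> (\<forall>v \<in> D. (w, v) \<in> parcs G))))
    \<and> (\<forall>u \<in> pverts G.
      (u \<notin> D \<and> (\<forall>v \<in> D. (u, v) \<in> parcs G) \<longrightarrow>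
        (\<exists>w \<in> pverts G. w \<noteq> u \<and> (u, w) \<notin> parcs G \<and> \<not> (\<forall>v \<in> D. (w, v) \<in> parcs G)))
      \<longleftrightarrow>
      (u \<in> (\<Inter>v \<in> D. open_nbhd G v) - D \<longrightarrow>
        \<not> co_nbhd G u \<subseteq> (\<Inter>v \<in> D. open_nbhd G v)))"
proof -
  interpret pair_graph G by fact
  show ?thesis
    unfolding interference_complete_co_nbhd_iff
    using nonneighbor_condition_iff[where D = D] by simp
qed

end
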